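(* Let $q \ge 2$ and let $\chi$ be a primitive Dirichlet character modulo $q$. For real $B \ge 1$ and real $\alpha$, \[ \frac{B}{2}\int_{\alpha - 1/B}^{\alpha + 1/B} S_\chi(tq)\, \mathrm{d} t = A(\chi) + \frac{\tau(\chi)}{i\pi}\sum_{1 \le n < B} \frac{\overline \chi(n)}{n} f(2 \pi n \alpha) + O\big(q^{1/2}\big), \] where $f(x) = -\cos(x)$ if $\chi(-1) = -1$ and $f(x) = i\sin(x)$ if $\chi(-1)=1$, and \[ A(\chi) = \frac{\big(1 - \chi(-1)\big)\tau(\chi)}{2\pi i} L(1, \overline \chi). \] The implied constant in $O(q^{1/2})$ is absolute.
   Context: For a Dirichlet character $\chi$ modulo $q$ and real $x$, $S_\chi(x) = \sum_{1 \le n \le x} \chi(n)$. The Gauss sum is $\tau(\chi) = \sum_{k=1}^{q} \chi(k) e^{2\pi i k/q}$, and $L(1,\overline\chi) = \sum_{n \ge 1} \overline\chi(n)/n$.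
   Formalization: For x < 0, S_χ(x) is read as minus the sum of χ(n) over x < n ≤ 0 (the q-periodic extension) instead of the empty sum 0; with the empty sum the claim fails, e.g. for α = 0, B = 1 and χ odd, where the two sides differ by A(χ)/2, which is not O(q^{1/2}). *)

theory Defs
  imports "HOL-Analysis.Analysis"
begin

definition dirichlet_character :: "nat \<Rightarrow> (int \<Rightarrow> complex) \<Rightarrow> bool" where
  "dirichlet_character q chi \<longleftrightarrow>
     q > 0 \<and>
     (\<forall>n. chi (n + int q) = chi n) \<and>
     (\<forall>m n. chi (m * n) = chi m * chi n) \<and>
     (\<forall>n. chi n \<noteq> 0 \<longleftrightarrow> coprime n (int q))"

definition induced_from :: "nat \<Rightarrow> nat \<Rightarrow> (int \<Rightarrow> complex) \<Rightarrow> bool" where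
  "induced_from d q chi \<longleftrightarrow>
     d dvd q \<and>
     (\<exists>\<psi>. dirichlet_character d \<psi> \<and> (\<forall>n. coprime n (int q) \<longrightarrow> chi n = \<psi> n))"

definition primitive_character :: "nat \<Rightarrow> (int \<Rightarrow> complex) \<Rightarrow> bool" where
  "primitive_character q chi \<longleftrightarrow>
     dirichlet_character q chi \<and> (\<forall>d<q. \<not> induced_from d q chi)"

text \<open>
  For \<open>x \<ge> 0\<close> the second sum is empty and this is the sum of \<open>chi n\<close> over \<open>1 \<le> n \<le> x\<close>.
  For \<open>x < 0\<close> the usual oriented-sum convention applies: the sum is minus the sum of
  \<open>chi n\<close> over \<open>x < n \<le> 0\<close>. For a non-principal character modulo \<open>q\<close> this is the
  \<open>q\<close>-periodic extension of the sum from \<open>x \<ge> 0\<close> to all real \<open>x\<close>.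
\<close>
definition char_sum :: "(int \<Rightarrow> complex) \<Rightarrow> real \<Rightarrow> complex" where
  "char_sum chi x =
     (\<Sum>n | 1 \<le> n \<and> real_of_int n \<le> x. chi n) - (\<Sum>n | x < real_of_int n \<and> n \<le> 0. chi n)"

lemma char_sum_nonneg:
  assumes "x \<ge> 0"
  shows "char_sum chi x = (\<Sum>n | 1 \<le> n \<and> real_of_int n \<le> x. chi n)"
proof -
  have "{n. x < real_of_int n \<and> n \<le> 0} = {}"
    using assms by auto
  then show ?thesis
    by (simp only: char_sum_def sum.empty diff_zero)
qed

definition gauss_sum :: "nat \<Rightarrow> (int \<Rightarrow> complex) \<Rightarrow> complex" where
  "gauss_sum q chi = (\<Sum>k=1..q. chi (int k) * exp (2 * of_real pi * \<i> * of_nat k / of_nat q))"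

definition L_one :: "(int \<Rightarrow> complex) \<Rightarrow> complex" where
  "L_one chi = (\<Sum>n. chi (int (Suc n)) / of_nat (Suc n))"

definition main_term :: "nat \<Rightarrow> (int \<Rightarrow> complex) \<Rightarrow> complex" where
  "main_term q chi =
     (1 - chi (- 1)) * gauss_sum q chi / (2 * of_real pi * \<i>) * L_one (\<lambda>n. cnj (chi n))"

text \<open>Every Dirichlet character has \<open>chi (- 1) \<in> {1, - 1}\<close>, so the two cases are exhaustive.\<close>
definition parity_kernel :: "(int \<Rightarrow> complex) \<Rightarrow> real \<Rightarrow> complex" where
  "parity_kernel chi x =
     (if chi (- 1) = - 1 then - of_real (cos x) else \<i> * of_real (sin x))"

end

theory Submission
  imports Defs "HOL-Number_Theory.Residues"
begin

text \<open>
  Write \<open>\<psi>(x) = {x} - 1/2\<close>. Counting the integers in each residue class modulo \<open>q\<close> gives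
  \<open>S(tq) = c - \<Sum>\<^sub>k \<chi>(k) \<psi>(t - k/q)\<close> with \<open>c = - \<Sum>\<^sub>k \<chi>(k) k/q\<close>. The Fourier series of \<open>\<psi>\<close>
  at the points \<open>k/q\<close>, together with \<open>\<Sum>\<^sub>k \<chi>(k) e(nk/q) = cnj(\<chi>(n)) \<tau>(\<chi>)\<close> for primitive \<open>\<chi>\<close>,
  identifies \<open>c\<close> with \<open>A(\<chi>)\<close>. The function \<open>F(x) = \<Sum>\<^sub>n cos(2\<pi>nx)/n\<^sup>2\<close> is continuous with
  \<open>F' = 2\<pi>\<^sup>2 \<psi>\<close> away from the integers, so averaging \<open>S(tq)\<close> over the window of radius \<open>1/B\<close> yields
  an absolutely convergent series: the series of the theorem over all \<open>n \<ge> 1\<close>, with the \<open>n\<close>-th term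
  weighted by \<open>w = sin(y)/y\<close>, \<open>y = 2\<pi>n/B\<close>. Since \<open>\<bar>w - 1\<bar> \<le> y/2\<close> for \<open>n < B\<close> and
  \<open>\<bar>w\<bar> \<le> 1/y\<close> for \<open>n \<ge> B\<close>, replacing the weight by a sharp cutoff at \<open>B\<close> costs \<open>O(1)\<close>,
  which is multiplied by \<open>\<bar>\<tau>(\<chi>)\<bar> = \<surd>q\<close>.
\<close>

section \<open>Fourier series of the sawtooth function\<close>

definition sawtooth :: "real \<Rightarrow> real" where
  "sawtooth x = frac x - 1 / 2"

definition cos_series :: "real \<Rightarrow> real" where
  "cos_series x = (\<Sum>n. cos (2 * pi * real (Suc n) * x) / real (Suc n) ^ 2)"

text \<open>The product \<open>2 sin(pi x) cos(2 pi n x)\<close> is a difference of sines at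
  consecutive odd multiples of \<open>pi x\<close>, so the sum telescopes. The factor
  \<open>sin (pi * x)\<close> stays on the left to avoid division.\<close>

lemma dirichlet_kernel:
  fixes x :: real
  shows "sin (pi * x) * (1 + 2 * (\<Sum>n<N. cos (2 * pi * real (Suc n) * x)))
         = sin (real (2 * N + 1) * pi * x)"
proof (induction N)
  case (Suc N)
  have "2 * (sin (pi * x) * cos (2 * pi * real (Suc N) * x))
        = sin (pi * x + 2 * pi * real (Suc N) * x) + sin (pi * x - 2 * pi * real (Suc N) * x)"
    by (simp add: sin_add sin_diff)
  also have "pi * x + 2 * pi * real (Suc N) * x = real (2 * Suc N + 1) * pi * x"
    by (simp add: algebra_simps)
  also have "pi * x - 2 * pi * real (Suc N) * x = - (real (2 * N + 1) * pi * x)"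
    by (simp add: algebra_simps)
  finally have "2 * (sin (pi * x) * cos (2 * pi * real (Suc N) * x))
    = sin (real (2 * Suc N + 1) * pi * x) - sin (real (2 * N + 1) * pi * x)"
    by simp
  with Suc.IH show ?case
    by (simp only: sum.lessThan_Suc ring_distribs mult.left_commute[of _ 2])
qed simp

text \<open>The error vanishes at \<open>1 / 2\<close>, so a derivative bound on the whole interval
  controls it everywhere. The bound is independent of \<open>x\<close>, which gives uniform
  convergence away from the integers.\<close>

lemma sin_series_partial_bound:
  fixes a x :: real
  assumes a: "0 < a" "a < 1 / 2" and x: "x \<in> {a..1 - a}"
  shows "\<bar>(\<Sum>n<N. sin (2 * pi * real (Suc n) * x) / real (Suc n)) - pi * (1 / 2 - x)\<bar>
         \<le> 5 / (real (2 * N + 1) * sin (pi * a) ^ 2)"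
proof -
  define m where "m = sin (pi * a)"
  define M where "M = real (2 * N + 1)"
  have M: "M > 0" by (simp add: M_def)
  have m: "0 < m" "m \<le> 1" using a by (auto simp: m_def intro!: sin_gt_zero)
  have mono: "m \<le> sin (pi * y)" if "a \<le> y" "y \<le> 1 / 2" for y
  proof -
    have "- (pi / 2) \<le> 0" "0 \<le> pi * a" "pi * a \<le> pi * y" "pi * y \<le> pi * (1 / 2)"
      using that a by (simp_all only: mult_left_mono pi_ge_zero) auto
    then show ?thesis unfolding m_def by (intro sin_monotone_2pi_le) linarith+
  qed
  have sin_ge: "m \<le> sin (pi * y)" if "y \<in> {a..1 - a}" for y
    using that mono[of y] mono[of "1 - y"] by (cases "y \<le> 1 / 2") (auto simp: right_diff_distrib)
  \<comment> \<open>The derivative of the difference is \<open>\<pi> sin(M\<pi>y) / sin(\<pi>y)\<close>, which is not small; adding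
    the boundary term of one integration by parts makes it \<open>O(1/M)\<close>.\<close>
  define E where "E = (\<lambda>y. (\<Sum>n<N. sin (2 * pi * real (Suc n) * y) / real (Suc n))
                       - pi * (1 / 2 - y) + cos (M * pi * y) / (M * sin (pi * y)))"
  define E' where "E' = (\<lambda>y. - (pi * cos (M * pi * y) * cos (pi * y) / (M * sin (pi * y) ^ 2)))"
  have deriv: "(E has_field_derivative E' y) (at y within {a..1 - a})" if y: "y \<in> {a..1 - a}" for y
  proof -
    have s: "sin (pi * y) > 0" using sin_ge[OF y] m by linarith
    have "((\<lambda>y. sin (2 * pi * c * y) / c) has_field_derivative 2 * pi * cos (2 * pi * c * y))
            (at y within {a..1 - a})" if "c > 0" for c
      using that by (auto intro!: derivative_eq_intros)
    from this[of "real (Suc n)" for n]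
    have "((\<lambda>y. \<Sum>n<N. sin (2 * pi * real (Suc n) * y) / real (Suc n)) has_field_derivative
            (\<Sum>n<N. 2 * pi * cos (2 * pi * real (Suc n) * y))) (at y within {a..1 - a})"
      by (intro DERIV_sum) simp
    moreover have "((\<lambda>y. pi * (1 / 2 - y)) has_field_derivative - pi) (at y within {a..1 - a})"
      by (auto intro!: derivative_eq_intros)
    moreover have "((\<lambda>y. cos (M * pi * y) / (M * sin (pi * y))) has_field_derivative
            ((- (sin (M * pi * y)) * (M * pi)) * (M * sin (pi * y))
                 - cos (M * pi * y) * (M * (cos (pi * y) * pi))) / (M * sin (pi * y))\<^sup>2)
            (at y within {a..1 - a})"
      using s M by (auto intro!: derivative_eq_intros simp: power2_eq_square)
    ultimately have "(E has_field_derivative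
            ((\<Sum>n<N. 2 * pi * cos (2 * pi * real (Suc n) * y)) - (- pi)
             + ((- (sin (M * pi * y)) * (M * pi)) * (M * sin (pi * y))
                 - cos (M * pi * y) * (M * (cos (pi * y) * pi))) / (M * sin (pi * y))\<^sup>2))
           (at y within {a..1 - a})"
      unfolding E_def by (intro DERIV_add DERIV_diff)
    moreover have "(\<Sum>n<N. 2 * pi * cos (2 * pi * real (Suc n) * y)) - (- pi)
             = pi * (1 + 2 * (\<Sum>n<N. cos (2 * pi * real (Suc n) * y)))"
      by (simp add: algebra_simps sum_distrib_left)
    moreover have "1 + 2 * (\<Sum>n<N. cos (2 * pi * real (Suc n) * y)) = sin (M * pi * y) / sin (pi * y)"
      using dirichlet_kernel[of y N] s by (simp only: M_def field_simps)
    moreover have "pi * (sin (M * pi * y) / sin (pi * y))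
             + ((- (sin (M * pi * y)) * (M * pi)) * (M * sin (pi * y))
                 - cos (M * pi * y) * (M * (cos (pi * y) * pi))) / (M * sin (pi * y))\<^sup>2 = E' y"
      unfolding E'_def using s M by (simp add: field_simps power2_eq_square)
    ultimately show ?thesis by simp
  qed
  have bound: "norm (E' y) \<le> pi / (M * m\<^sup>2)" if y: "y \<in> {a..1 - a}" for y
  proof -
    have "\<bar>cos (M * pi * y) * cos (pi * y)\<bar> \<le> 1"
      unfolding abs_mult by (intro mult_le_one) auto
    then have "pi * \<bar>cos (M * pi * y) * cos (pi * y)\<bar> \<le> pi * 1"
      by (intro mult_left_mono) auto
    moreover have "M * m\<^sup>2 \<le> M * (sin (pi * y))\<^sup>2"
      using sin_ge[OF y] m M by (intro mult_left_mono power_mono) auto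
    ultimately show ?thesis
      unfolding E'_def using M m
      by (simp add: abs_mult) (intro frac_le, auto simp: abs_mult mult.assoc)
  qed
  \<comment> \<open>At \<open>1 / 2\<close> every sine is taken at a multiple of \<open>pi\<close>,
    and the boundary term vanishes because \<open>M\<close> is odd.\<close>
  have "E (1 / 2) = 0"
  proof -
    have "sin (2 * pi * real (Suc n) * (1 / 2)) = 0" for n
      using sin_npi2[of "Suc n"] by (simp add: mult.commute)
    moreover have "cos (M * pi * (1 / 2)) = 0"
    proof -
      have "M * pi * (1 / 2) = real N * pi + pi / 2" by (simp add: M_def field_simps)
      then show ?thesis by (simp only: cos_add) simp
    qed
    ultimately show ?thesis by (simp only: E_def) simp
  qed
  moreover have "norm (E x - E (1 / 2)) \<le> pi / (M * m\<^sup>2) * norm (x - 1 / 2)"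
    using a x by (intro field_differentiable_bound[OF _ deriv bound]) auto
  moreover have "pi / (M * m\<^sup>2) * norm (x - 1 / 2) \<le> pi / (M * m\<^sup>2) * 1"
    using a x M by (intro mult_left_mono) auto
  ultimately have E_le: "\<bar>E x\<bar> \<le> pi / (M * m\<^sup>2)" by simp
  have "\<bar>cos (M * pi * x) / (M * sin (pi * x))\<bar> \<le> 1 / (M * m\<^sup>2)"
  proof -
    \<comment> \<open>The boundary term has only one factor of the sine below; weakening
      \<open>m\<close> to its square gives both errors the same denominator.\<close>
    have "m\<^sup>2 \<le> m" using m by (simp add: power2_eq_square mult_left_le)
    then have "M * m\<^sup>2 \<le> M * sin (pi * x)"
      using sin_ge[OF x] M by (intro mult_left_mono) auto
    moreover have "sin (pi * x) > 0" using sin_ge[OF x] m by linarith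
    ultimately show ?thesis using M m
      by (simp add: abs_mult) (intro frac_le, auto)
  qed
  with E_le have "\<bar>(\<Sum>n<N. sin (2 * pi * real (Suc n) * x) / real (Suc n)) - pi * (1 / 2 - x)\<bar>
      \<le> pi / (M * m\<^sup>2) + 1 / (M * m\<^sup>2)"
    unfolding E_def by linarith
  also have "\<dots> = (pi + 1) / (M * m\<^sup>2)" by (simp add: add_divide_distrib)
  also have "\<dots> \<le> 5 / (M * m\<^sup>2)"
    using pi_less_4 M m by (intro divide_right_mono) auto
  finally show ?thesis by (simp only: M_def m_def)
qed

text \<open>Pointwise convergence would not suffice: differentiating the cosine series term by term
  needs uniform convergence of the derivatives.\<close>

lemma uniform_limit_sin_series:
  fixes a :: real
  assumes a: "0 < a" "a < 1 / 2"
  shows "uniform_limit {a..1 - a} (\<lambda>N x. \<Sum>n<N. sin (2 * pi * real (Suc n) * x) / real (Suc n))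
           (\<lambda>x. pi * (1 / 2 - x)) sequentially"
proof -
  have "(\<lambda>N. 5 / (real (2 * N + 1) * sin (pi * a) ^ 2)) \<longlonglongrightarrow> 0"
  proof -
    have "(\<lambda>N. inverse (real (Suc (2 * N)))) \<longlonglongrightarrow> 0"
      by (rule LIMSEQ_subseq_LIMSEQ[OF LIMSEQ_inverse_real_of_nat, of "\<lambda>n. 2 * n", unfolded o_def])
         (auto simp: strict_mono_def)
    then have "(\<lambda>N. 5 / sin (pi * a) ^ 2 * inverse (real (Suc (2 * N)))) \<longlonglongrightarrow> 5 / sin (pi * a) ^ 2 * 0"
      by (intro tendsto_mult_left)
    then show ?thesis by (simp add: field_simps)
  qed
  show ?thesis
  proof (rule uniform_limitI)
    fix e :: real assume "e > 0"
    with order_tendstoD(2)[OF \<open>(\<lambda>N. 5 / (real (2 * N + 1) * sin (pi * a) ^ 2)) \<longlonglongrightarrow> 0\<close>]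
    have "\<forall>\<^sub>F N in sequentially. 5 / (real (2 * N + 1) * sin (pi * a) ^ 2) < e" by blast
    then show "\<forall>\<^sub>F N in sequentially. \<forall>x\<in>{a..1 - a}.
        dist (\<Sum>n<N. sin (2 * pi * real (Suc n) * x) / real (Suc n)) (pi * (1 / 2 - x)) < e"
    proof eventually_elim
      case (elim N)
      then show ?case
        using sin_series_partial_bound[OF a, where N = N] unfolding dist_real_def
        by (blast intro: le_less_trans)
    qed
  qed
qed

lemma frac_in_subinterval:
  fixes x :: real
  assumes "x \<notin> \<int>"
  obtains a where "0 < a" "a < 1 / 2" "frac x \<in> {a<..<1 - a}"
proof
  have f: "0 < frac x" "frac x < 1"
    using assms by (simp_all add: frac_gt_0_iff frac_lt_1)
  show "0 < min (frac x) (1 - frac x) / 2" "min (frac x) (1 - frac x) / 2 < 1 / 2"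
       "frac x \<in> {min (frac x) (1 - frac x) / 2<..<1 - min (frac x) (1 - frac x) / 2}"
    using f by (auto simp: min_def field_simps)
qed

lemma two_pi_nat_frac:
  fixes x :: real
  shows "sin (2 * pi * real n * frac x) = sin (2 * pi * real n * x)"
    and "cos (2 * pi * real n * frac x) = cos (2 * pi * real n * x)"
proof -
  have eq: "2 * pi * real n * frac x = 2 * pi * real n * x - 2 * pi * real_of_int (int n * \<lfloor>x\<rfloor>)"
    by (simp add: frac_def algebra_simps)
  show "sin (2 * pi * real n * frac x) = sin (2 * pi * real n * x)"
    unfolding eq sin_diff by (simp add: sin_int_2pin cos_int_2pin del: of_int_mult)
  show "cos (2 * pi * real n * frac x) = cos (2 * pi * real n * x)"
    unfolding eq cos_diff by (simp add: sin_int_2pin cos_int_2pin del: of_int_mult)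
qed

text \<open>By periodicity \<open>x\<close> may be replaced by \<open>frac x\<close>, which lies
  inside some interval of uniform convergence. At integers the series gives 0 whereas
  \<open>sawtooth\<close> is \<open>- 1 / 2\<close>, hence the hypothesis.\<close>

lemma sin_series_sums_sawtooth:
  fixes x :: real
  assumes "x \<notin> \<int>"
  shows "(\<lambda>n. sin (2 * pi * real (Suc n) * x) / real (Suc n)) sums (- pi * sawtooth x)"
proof -
  obtain a where a: "0 < a" "a < 1 / 2" "frac x \<in> {a<..<1 - a}"
    using frac_in_subinterval[OF assms] .
  have "(\<lambda>N. \<Sum>n<N. sin (2 * pi * real (Suc n) * frac x) / real (Suc n)) \<longlonglongrightarrow> pi * (1 / 2 - frac x)"
    using a by (intro tendsto_uniform_limitI[OF uniform_limit_sin_series[OF a(1,2)]]) auto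
  then show ?thesis
    unfolding sums_def two_pi_nat_frac by (simp add: sawtooth_def algebra_simps)
qed

section \<open>The cosine series as an antiderivative of the sawtooth\<close>

lemma summable_inverse_square_Suc: "summable (\<lambda>n. 1 / real (Suc n) ^ 2)"
  using inverse_power_summable[of 2, where 'a = real]
  by (subst summable_Suc_iff[of "\<lambda>n. 1 / real n ^ 2"]) (simp add: inverse_eq_divide)

lemma summable_cos_series:
  "summable (\<lambda>n. cos (2 * pi * real (Suc n) * x) / real (Suc n) ^ 2)"
  by (rule summable_comparison_test'[OF summable_inverse_square_Suc])
     (simp add: divide_right_mono del: of_nat_Suc)

lemma cos_series_frac: "cos_series (frac x) = cos_series x"
  unfolding cos_series_def two_pi_nat_frac ..

text \<open>Weierstrass M-test against the inverse squares. Continuity at the integers carries the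
  antiderivative across the jumps of the sawtooth.\<close>

lemma continuous_on_cos_series: "continuous_on S cos_series"
proof -
  have "uniform_limit UNIV (\<lambda>N x. \<Sum>n<N. cos (2 * pi * real (Suc n) * x) / real (Suc n) ^ 2)
          (\<lambda>x. \<Sum>n. cos (2 * pi * real (Suc n) * x) / real (Suc n) ^ 2) sequentially"
    by (rule Weierstrass_m_test[OF _ summable_inverse_square_Suc])
       (simp add: divide_right_mono del: of_nat_Suc)
  then have "continuous_on UNIV cos_series"
    unfolding cos_series_def[abs_def]
    by (rule uniform_limit_theorem[rotated])
       (auto intro!: always_eventually continuous_intros simp del: of_nat_Suc)
  then show ?thesis by (rule continuous_on_subset) simp
qed

lemma cos_series_has_derivative:
  assumes "x \<notin> \<int>"
  shows "(cos_series has_field_derivative 2 * pi\<^sup>2 * sawtooth x) (at x)"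
proof -
  obtain a where a: "0 < a" "a < 1 / 2" "frac x \<in> {a<..<1 - a}"
    using frac_in_subinterval[OF assms] .
  have lim: "uniform_limit {a..1 - a}
      (\<lambda>N y. \<Sum>n<N. - 2 * pi * (sin (2 * pi * real (Suc n) * y) / real (Suc n)))
      (\<lambda>y. - 2 * pi * (pi * (1 / 2 - y))) sequentially"
    unfolding sum_distrib_left[symmetric]
    by (rule bounded_linear.uniform_limit[OF bounded_linear_mult_right uniform_limit_sin_series])
       (use a in auto)
  have "((\<lambda>y. cos (2 * pi * real (Suc n) * y) / real (Suc n) ^ 2) has_field_derivative
          - 2 * pi * (sin (2 * pi * real (Suc n) * y) / real (Suc n))) (at y within {a..1 - a})" for n y
  proof -
    define c where "c = real (Suc n)"
    have "c > 0" by (simp add: c_def)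
    then show ?thesis unfolding c_def[symmetric]
      by (auto intro!: derivative_eq_intros simp: field_simps power2_eq_square)
  qed
  from has_field_derivative_series[OF _ this lim _ summable_cos_series, of "1/2"] a
  obtain g where g: "\<And>y. y \<in> {a..1 - a} \<Longrightarrow>
      (\<lambda>n. cos (2 * pi * real (Suc n) * y) / real (Suc n) ^ 2) sums g y"
    "\<And>y. y \<in> {a..1 - a} \<Longrightarrow>
      (g has_field_derivative - 2 * pi * (pi * (1 / 2 - y))) (at y within {a..1 - a})"
    by force
  have g_eq: "g y = cos_series y" if "y \<in> {a..1 - a}" for y
    using g(1)[OF that] by (simp add: cos_series_def sums_iff)
  have "(g has_field_derivative 2 * pi\<^sup>2 * sawtooth x) (at (frac x))"
    using g(2)[of "frac x"] a
    by (simp add: at_within_Icc_at sawtooth_def power2_eq_square algebra_simps)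
  then have "(cos_series has_field_derivative 2 * pi\<^sup>2 * sawtooth x) (at (frac x))"
    by (rule has_field_derivative_transform_within_open[of _ _ _ "{a<..<1 - a}"])
       (use a g_eq in auto)
  \<comment> \<open>The integer part of \<open>x\<close> is kept fixed while \<open>y\<close>
    varies, so the derivative at \<open>frac x\<close> moves to \<open>x\<close> by a translation
    under which \<open>cos_series\<close> is invariant.\<close>
  then have "((\<lambda>y. cos_series (y - of_int \<lfloor>x\<rfloor>)) has_field_derivative 2 * pi\<^sup>2 * sawtooth x) (at x)"
    using DERIV_shift[of cos_series "2 * pi\<^sup>2 * sawtooth x" x "- of_int \<lfloor>x\<rfloor>"]
    by (simp add: frac_def)
  moreover have "cos_series (y - of_int \<lfloor>x\<rfloor>) = cos_series y" for y
    using cos_series_frac[of "y - of_int \<lfloor>x\<rfloor>"] cos_series_frac[of y]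
    by (simp add: frac_def)
  ultimately show ?thesis by simp
qed

text \<open>A continuous antiderivative may fail to be differentiable at finitely many points, here
  the integers of the interval.\<close>

lemma sawtooth_has_integral:
  assumes "a \<le> b"
  shows "(sawtooth has_integral (cos_series b - cos_series a) / (2 * pi\<^sup>2)) {a..b}"
proof -
  have "((\<lambda>x. cos_series x / (2 * pi\<^sup>2)) has_vector_derivative sawtooth x) (at x)"
    if "x \<in> {a<..<b} - {x \<in> \<int>. a \<le> x \<and> x \<le> b}" for x
  proof -
    have "x \<notin> \<int>" using that by auto
    from DERIV_cdivide[OF cos_series_has_derivative[OF this], of "2 * pi\<^sup>2"]
    show ?thesis by (simp add: has_real_derivative_iff_has_vector_derivative)
  qed
  moreover have "continuous_on {a..b} (\<lambda>x. cos_series x / (2 * pi\<^sup>2))"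
    by (intro continuous_intros continuous_on_cos_series) auto
  ultimately show ?thesis
    using fundamental_theorem_of_calculus_interior_strong[OF finite_int_segment[of a b] assms]
    unfolding diff_divide_distrib by blast
qed

text \<open>Product-to-sum for each term. The second sine over \<open>real (Suc n)\<close> will
  become the smoothing weight when \<open>d = 1 / B\<close>.\<close>

lemma cos_series_diff_sums:
  "(\<lambda>n. - 2 * sin (2 * pi * real (Suc n) * x) * sin (2 * pi * real (Suc n) * d) / real (Suc n) ^ 2)
     sums (cos_series (x + d) - cos_series (x - d))"
proof -
  have product: "cos (2 * pi * c * (x + d)) / c\<^sup>2 - cos (2 * pi * c * (x - d)) / c\<^sup>2
     = - 2 * sin (2 * pi * c * x) * sin (2 * pi * c * d) / c\<^sup>2" for c :: real
    by (simp add: distrib_left right_diff_distrib cos_add cos_diff flip: diff_divide_distrib)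
  have "(\<lambda>n. cos (2 * pi * real (Suc n) * y) / real (Suc n) ^ 2) sums cos_series y" for y
    using summable_cos_series by (simp add: cos_series_def sums_iff)
  from sums_diff[OF this[of "x + d"] this[of "x - d"]] show ?thesis unfolding product .
qed

section \<open>Gauss sums of primitive characters\<close>

definition unit_root :: "nat \<Rightarrow> int \<Rightarrow> complex" where
  "unit_root q k = cis (2 * pi * real_of_int k / real q)"

lemma unit_root_add: "unit_root q (a + b) = unit_root q a * unit_root q b"
  by (simp add: unit_root_def cis_mult add_divide_distrib distrib_left)

lemma unit_root_mult_modulus:
  assumes "q > 0"
  shows "unit_root q (int q * k) = 1"
proof -
  have "2 * pi * real_of_int (int q * k) / real q = 2 * pi * real_of_int k"
    using assms by simp
  then show ?thesis by (simp only: unit_root_def cis_multiple_2pi Ints_of_int)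
qed

lemma unit_root_cong:
  assumes "q > 0" "[a = b] (mod int q)"
  shows "unit_root q a = unit_root q b"
proof -
  obtain k where "a = b + int q * k"
    using assms(2) by (metis cong_iff_lin cong_sym)
  then show ?thesis by (simp only: unit_root_add unit_root_mult_modulus[OF assms(1)] mult_1_right)
qed

lemma unit_root_power: "unit_root q (int n * m) = unit_root q m ^ n"
  by (induction n) (simp_all add: unit_root_add distrib_right, simp add: unit_root_def)

lemma unit_root_eq_1_iff:
  assumes "q > 0"
  shows "unit_root q m = 1 \<longleftrightarrow> int q dvd m"
proof
  assume "unit_root q m = 1"
  then have "cos (2 * pi * real_of_int m / real q) = 1"
    by (simp add: unit_root_def complex_eq_iff)
  then obtain k :: int where "2 * pi * real_of_int m / real q = real_of_int k * 2 * pi"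
    by (auto simp: cos_one_2pi_int)
  then have "real_of_int m = real_of_int (int q * k)"
    using assms by (simp add: field_simps)
  then show "int q dvd m" by (simp only: of_int_eq_iff dvd_triv_left)
next
  assume "int q dvd m"
  then show "unit_root q m = 1"
    using assms by (auto elim!: dvdE simp: unit_root_mult_modulus)
qed

lemma sum_unit_root:
  assumes "q > 0"
  shows "(\<Sum>k\<in>{0..<int q}. unit_root q (k * m)) = (if int q dvd m then of_nat q else 0)"
proof -
  have "(\<Sum>k\<in>{0..<int q}. unit_root q (k * m)) = (\<Sum>k<q. unit_root q m ^ k)"
    by (rule sum.reindex_bij_witness[of _ int nat]) (auto simp flip: unit_root_power)
  also have "\<dots> = (if int q dvd m then of_nat q else 0)"
  proof (cases "int q dvd m")
    case True
    then have "unit_root q m = 1" using unit_root_eq_1_iff[OF assms] by blast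
    with True show ?thesis by simp
  next
    case False
    then have "unit_root q m \<noteq> 1" using unit_root_eq_1_iff[OF assms] by blast
    moreover have "unit_root q m ^ q = 1"
      using unit_root_mult_modulus[OF assms, of m] by (simp add: unit_root_power)
    ultimately show ?thesis using False by (simp add: geometric_sum)
  qed
  finally show ?thesis .
qed

text \<open>Multiplication by a unit permutes the residues: cancellation makes it injective on a
  finite set.\<close>

lemma sum_residues_mult:
  fixes f :: "int \<Rightarrow> 'a :: comm_monoid_add"
  assumes q: "q > 0" and cop: "coprime a (int q)"
    and per: "\<And>m n. [m = n] (mod int q) \<Longrightarrow> f m = f n"
  shows "(\<Sum>k\<in>{0..<int q}. f (a * k)) = (\<Sum>k\<in>{0..<int q}. f k)"
proof -
  have "inj_on (\<lambda>k. a * k mod int q) {0..<int q}"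
  proof (rule inj_onI)
    fix x y assume xy: "x \<in> {0..<int q}" "y \<in> {0..<int q}" "a * x mod int q = a * y mod int q"
    then have "[x = y] (mod int q)"
      using cong_mult_lcancel[OF cop] by (auto simp: cong_def)
    with xy show "x = y" by (auto simp: cong_def)
  qed
  then have "bij_betw (\<lambda>k. a * k mod int q) {0..<int q} {0..<int q}"
    using q by (intro bij_betw_imageI endo_inj_surj) auto
  from sum.reindex_bij_betw[OF this, of f]
  have "(\<Sum>k\<in>{0..<int q}. f (a * k mod int q)) = (\<Sum>k\<in>{0..<int q}. f k)" .
  moreover have "f (a * k mod int q) = f (a * k)" for k
    by (rule per) simp
  ultimately show ?thesis by simp
qed

text \<open>Take \<open>j\<close> to be the product of the primes dividing \<open>q\<close> but not
  \<open>n\<close>. Each prime divisor of \<open>q\<close> then divides exactly one of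
  \<open>n\<close> and \<open>int d * j\<close>, hence not their sum. For \<open>d\<close> dividing
  \<open>q\<close> this lifts units modulo \<open>d\<close> to units modulo
  \<open>q\<close>.\<close>

lemma coprime_lift:
  fixes n :: int and d q :: nat
  assumes "coprime n (int d)" "q > 0"
  shows "\<exists>j. coprime (n + int d * j) (int q)"
proof
  define P where "P = {p. prime p \<and> p dvd q \<and> \<not> int p dvd n}"
  have fin: "finite P"
    by (rule finite_subset[of _ "{..q}"]) (use assms(2) in \<open>auto simp: P_def dest: dvd_imp_le\<close>)
  define j where "j = int (\<Prod>p\<in>P. p)"
  have "\<not> int p dvd n + int d * j" if p: "prime p" "p dvd q" for p
  proof (cases "int p dvd n")
    case True
    have "\<not> p dvd \<Prod>P"
    proof
      assume "p dvd \<Prod>P"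
      then obtain r where "r \<in> P" "p dvd r"
        using prime_dvd_prod_iff[OF fin p(1), of "\<lambda>p. p"] by auto
      with p have "p = r" by (auto simp: P_def primes_dvd_imp_eq)
      with \<open>r \<in> P\<close> True show False by (simp add: P_def)
    qed
    moreover have "\<not> int p dvd int d"
      using True assms(1) p(1)
      by (meson coprime_common_divisor not_prime_unit prime_nat_int_transfer)
    ultimately have "\<not> int p dvd int d * j"
      using p(1) by (simp add: j_def prime_dvd_mult_iff del: of_nat_prod flip: of_nat_mult)
    with True show ?thesis by (simp add: dvd_add_right_iff)
  next
    case False
    with p fin have "p dvd \<Prod>P" by (intro dvd_prodI) (auto simp: P_def)
    then have "int p dvd int d * j" unfolding j_def by (simp only: dvd_mult int_dvd_int_iff)
    with False show ?thesis by (simp add: dvd_add_left_iff)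
  qed
  note not_dvd = this
  show "coprime (n + int d * j) (int q)"
  proof (rule ccontr)
    assume "\<not> coprime (n + int d * j) (int q)"
    then have "\<bar>gcd (n + int d * j) (int q)\<bar> \<noteq> 1" by (simp add: coprime_iff_gcd_eq_1)
    then obtain p where p: "prime p" "p dvd gcd (n + int d * j) (int q)"
      using prime_factor_int by blast
    moreover from p(1) have "int (nat p) = p" by (simp add: prime_ge_0_int)
    ultimately show False
      using not_dvd[of "nat p"] by (metis gcd_greatest_iff int_dvd_int_iff prime_nat_int_transfer)
  qed
qed

section \<open>Dirichlet characters, descent to a divisor, and twisted Gauss sums\<close>

locale dirichlet_char =
  fixes q :: nat and chi :: "int \<Rightarrow> complex"
  assumes character: "dirichlet_character q chi"
begin

lemma q_pos: "q > 0"
  and chi_period: "chi (n + int q) = chi n"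
  and chi_mult: "chi (m * n) = chi m * chi n"
  and chi_nonzero_iff: "chi n \<noteq> 0 \<longleftrightarrow> coprime n (int q)"
  using character by (auto simp: dirichlet_character_def)

lemma chi_period_mult: "chi (n + int q * k) = chi n"
proof (induction k rule: int_induct[where k = 0])
  case (step1 i)
  then show ?case using chi_period[of "n + int q * i"] by (simp add: algebra_simps)
next
  case (step2 i)
  then show ?case using chi_period[of "n + int q * (i - 1)"] by (simp add: algebra_simps)
qed simp

lemma chi_cong:
  assumes "[m = n] (mod int q)"
  shows "chi m = chi n"
  using assms by (metis chi_period_mult cong_iff_lin)

lemma chi_1: "chi 1 = 1"
  using chi_mult[of 1 1] chi_nonzero_iff[of 1] by simp

lemma chi_power: "chi (n ^ k) = chi n ^ k"
  by (induction k) (simp_all add: chi_1 chi_mult)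

lemma norm_chi:
  assumes "coprime n (int q)"
  shows "norm (chi n) = 1"
proof -
  \<comment> \<open>Euler's theorem, applied to a natural representative of \<open>n\<close>, makes
    \<open>chi n\<close> a root of unity.\<close>
  define a where "a = nat (n mod int q)"
  have a: "int a = n mod int q" using q_pos by (simp add: a_def)
  then have "coprime (int a) (int q)" using assms q_pos by (simp add: coprime_mod_left_iff)
  then have "[a ^ totient q = 1] (mod q)" by (intro euler_theorem) simp
  then have "[int a ^ totient q = 1] (mod int q)"
    using cong_int_iff[of "a ^ totient q" 1 q] by simp
  from chi_cong[OF this] have "chi (int a) ^ totient q = 1" by (simp add: chi_power chi_1)
  moreover have "chi (int a) = chi n" unfolding a by (rule chi_cong) simp
  ultimately show ?thesis using power_eq_1_iff[of "chi n" "totient q"] q_pos by auto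
qed

lemma norm_chi_le: "norm (chi n) \<le> 1"
  using norm_chi[of n] chi_nonzero_iff[of n] by (cases "coprime n (int q)") auto

lemma chi_minus_1: "chi (- 1) = 1 \<or> chi (- 1) = - 1"
  using chi_mult[of "- 1" "- 1"] by (simp add: chi_1 square_eq_1_iff)

lemma chi_minus: "chi (- n) = chi (- 1) * chi n"
  using chi_mult[of "- 1" n] by simp

text \<open>A character trivial on the kernel of reduction modulo \<open>d\<close> is constant on
  its fibres, so it descends to a character modulo \<open>d\<close>.\<close>

lemma induced_from_if_trivial_on_kernel:
  assumes d: "d dvd q"
    and triv: "\<And>a. coprime a (int q) \<Longrightarrow> [a = 1] (mod int d) \<Longrightarrow> chi a = 1"
  shows "induced_from d q chi"
proof -
  have d_pos: "d > 0" using d q_pos by (auto intro: Nat.gr0I)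
  have eq: "chi a = chi b"
    if ab: "coprime a (int q)" "coprime b (int q)" "[a = b] (mod int d)" for a b
  proof -
    \<comment> \<open>With \<open>c\<close> inverse to \<open>b\<close> modulo \<open>q\<close>, the
      product \<open>a * c\<close> is congruent to 1 modulo \<open>d\<close> and so lies in the
      kernel.\<close>
    obtain c where c: "[b * c = 1] (mod int q)"
      using cong_solve_coprime_int[OF ab(2)] by blast
    then have bc: "chi b * chi c = 1" using chi_cong[OF c] by (simp add: chi_mult chi_1)
    then have "coprime c (int q)" using chi_nonzero_iff[of c] by auto
    moreover have "[b * c = 1] (mod int d)"
      using c d by (meson cong_dvd_modulus int_dvd_int_iff)
    then have "[a * c = 1] (mod int d)"
      using ab(3) by (meson cong_scalar_right cong_trans)
    ultimately have "chi a * chi c = 1" using triv[of "a * c"] ab(1) by (simp add: chi_mult)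
    with bc show ?thesis by (metis mult_cancel_right mult_zero_right zero_neq_one)
  qed
  have "\<forall>n. \<exists>m. coprime n (int d) \<longrightarrow> coprime m (int q) \<and> [m = n] (mod int d)"
  proof
    fix n
    show "\<exists>m. coprime n (int d) \<longrightarrow> coprime m (int q) \<and> [m = n] (mod int d)"
      using coprime_lift[OF _ q_pos, of n d] by (metis cong_add_lcancel_0 cong_mult_self_left)
  qed
  then obtain L where L: "\<And>n. coprime n (int d) \<Longrightarrow> coprime (L n) (int q)"
      "\<And>n. coprime n (int d) \<Longrightarrow> [L n = n] (mod int d)"
    by metis
  \<comment> \<open>The choice of the lift \<open>L n\<close> is immaterial: by \<open>eq\<close>,
    all lifts of \<open>n\<close> coprime to \<open>q\<close> have the same value of
    \<open>chi\<close>.\<close>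
  define \<psi> where "\<psi> = (\<lambda>n. if coprime n (int d) then chi (L n) else 0)"
  have cop_dq: "coprime n (int d)" if "coprime n (int q)" for n
    using that d by (meson coprime_divisors dvd_refl int_dvd_int_iff)
  have "dirichlet_character d \<psi>"
    unfolding dirichlet_character_def
  proof (intro conjI allI)
    show "d > 0" by fact
    have cop_add: "coprime (n + int d) (int d) \<longleftrightarrow> coprime n (int d)" for n
      by (simp add: coprime_iff_gcd_eq_1)
    show "\<psi> (n + int d) = \<psi> n" for n
    proof (cases "coprime n (int d)")
      case True
      then have T': "coprime (n + int d) (int d)" by (simp only: cop_add)
      have "[L (n + int d) = L n] (mod int d)"
        using L(2)[OF True] L(2)[OF T'] by (simp add: cong_def)
      with True T' show ?thesis using eq L(1) by (simp add: \<psi>_def)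
    qed (simp add: \<psi>_def cop_add)
    show "\<psi> (m * n) = \<psi> m * \<psi> n" for m n
    proof (cases "coprime m (int d) \<and> coprime n (int d)")
      case True
      then have T': "coprime (m * n) (int d)" by simp
      have "[L (m * n) = L m * L n] (mod int d)"
        using True T' L(2) by (meson cong_mult cong_sym cong_trans)
      then have "chi (L (m * n)) = chi (L m * L n)"
        using True T' L(1) by (intro eq) auto
      with True T' show ?thesis by (simp add: \<psi>_def chi_mult)
    qed (auto simp: \<psi>_def)
    show "\<psi> n \<noteq> 0 \<longleftrightarrow> coprime n (int d)" for n
      using L(1)[of n] chi_nonzero_iff[of "L n"] by (simp add: \<psi>_def)
  qed
  moreover have "chi n = \<psi> n" if "coprime n (int q)" for n
    using eq[OF that L(1)[OF cop_dq[OF that]]] L(2)[OF cop_dq[OF that]] cop_dq[OF that]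
    by (simp add: \<psi>_def cong_sym)
  ultimately show ?thesis using d unfolding induced_from_def by blast
qed

text \<open>The Gauss sum at frequency \<open>n\<close>, taken over the residues from 0 so that
  permutations of residues apply directly.\<close>

definition twisted_sum :: "int \<Rightarrow> complex" where
  "twisted_sum n = (\<Sum>k\<in>{0..<int q}. chi k * unit_root q (n * k))"

lemma gauss_sum_eq: "gauss_sum q chi = twisted_sum 1"
proof -
  have exp_eq: "exp (2 * of_real pi * \<i> * of_nat k / of_nat q) = unit_root q (int k)" for k
    by (simp add: unit_root_def cis_conv_exp mult_ac)
  define f where "f k = chi (int k) * unit_root q (int k)" for k
  have f_q: "f q = f 0"
    using chi_period[of 0] unit_root_mult_modulus[OF q_pos, of 1] by (simp add: f_def unit_root_def)
  have "gauss_sum q chi = (\<Sum>k=1..q. f k)"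
    by (simp only: gauss_sum_def f_def exp_eq)
  also have "\<dots> = (\<Sum>k\<in>{0..<q}. f k)"
    using sum.atLeast_Suc_atMost[of 0 q f] sum.atLeastLessThan_Suc[of 0 q f] f_q
    by (simp add: atLeastLessThanSuc_atLeastAtMost)
  also have "\<dots> = twisted_sum 1"
    unfolding twisted_sum_def f_def
    by (rule sum.reindex_bij_witness[of _ nat int]) auto
  finally show ?thesis .
qed

text \<open>Substitute \<open>a * k\<close> for \<open>k\<close> in the sum over residues.\<close>

lemma twisted_sum_mult:
  assumes "coprime a (int q)"
  shows "chi a * twisted_sum (n * a) = twisted_sum n"
proof -
  have "chi a * twisted_sum (n * a) = (\<Sum>k\<in>{0..<int q}. chi (a * k) * unit_root q (n * (a * k)))"
    by (simp add: twisted_sum_def sum_distrib_left chi_mult mult_ac)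
  also have "\<dots> = twisted_sum n"
    unfolding twisted_sum_def
    by (rule sum_residues_mult[OF q_pos assms, where f = "\<lambda>k. chi k * unit_root q (n * k)"])
       (metis chi_cong unit_root_cong[OF q_pos] cong_scalar_left)
  finally show ?thesis .
qed

lemma twisted_sum_cong:
  assumes "[m = n] (mod int q)"
  shows "twisted_sum m = twisted_sum n"
  unfolding twisted_sum_def
  by (intro sum.cong refl arg_cong2[of _ _ _ _ "(*)"] unit_root_cong q_pos cong_scalar_right assms)

lemma twisted_sum_coprime:
  assumes "coprime n (int q)"
  shows "twisted_sum n = cnj (chi n) * gauss_sum q chi"
proof -
  have "cnj (chi n) * gauss_sum q chi = cnj (chi n) * chi n * twisted_sum n"
    using twisted_sum_mult[OF assms, of 1] by (simp add: gauss_sum_eq mult_ac)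
  also have "cnj (chi n) * chi n = 1"
    using norm_chi[OF assms] complex_norm_square[of "chi n"] by (simp add: mult.commute)
  finally show ?thesis by simp
qed

end

section \<open>Gauss sums of primitive characters\<close>

locale primitive_char =
  fixes q :: nat and chi :: "int \<Rightarrow> complex"
  assumes primitive: "primitive_character q chi" and q_ge_2: "q \<ge> 2"

sublocale primitive_char \<subseteq> dirichlet_char
  using primitive by unfold_locales (simp add: primitive_character_def)

context primitive_char
begin

text \<open>This is where primitivity enters. With \<open>d = q / gcd(n, q)\<close>, each unit
  \<open>a\<close> congruent to 1 modulo \<open>d\<close> fixes \<open>n\<close> modulo
  \<open>q\<close>, so \<open>chi a * twisted_sum n = twisted_sum n\<close>. A nonzero sum would
  make \<open>chi\<close> trivial on the kernel, hence induced from \<open>d < q\<close>.\<close>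

lemma twisted_sum_not_coprime:
  assumes "\<not> coprime n (int q)"
  shows "twisted_sum n = 0"
proof (rule ccontr)
  assume nz: "twisted_sum n \<noteq> 0"
  define g where "g = gcd n (int q)"
  have "g \<noteq> 1" using assms by (simp add: g_def coprime_iff_gcd_eq_1)
  moreover have "g > 0" using q_pos by (simp add: g_def)
  ultimately have g: "g > 1" by linarith
  define d where "d = nat (int q div g)"
  have gd: "int q = g * int d"
    using g pos_imp_zdiv_nonneg_iff[of g "int q"] by (simp add: d_def) (simp add: g_def)
  have "d \<noteq> 0" using gd q_pos by (intro notI) simp
  then have "int d < int q" unfolding gd using g by simp
  then have "d < q" by simp
  moreover have "induced_from d q chi"
  proof (rule induced_from_if_trivial_on_kernel)
    show "d dvd q" using gd by (metis dvd_triv_right int_dvd_int_iff)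
    fix a assume a: "coprime a (int q)" "[a = 1] (mod int d)"
    have "g * int d dvd n * (a - 1)"
      using a(2) by (intro mult_dvd_mono) (auto simp: g_def cong_iff_dvd_diff)
    then have "[n * a = n] (mod int q)"
      unfolding gd[symmetric] by (simp add: cong_iff_dvd_diff right_diff_distrib)
    from twisted_sum_cong[OF this] have "chi a * twisted_sum n = 1 * twisted_sum n"
      using twisted_sum_mult[OF a(1), of n] by simp
    with nz show "chi a = 1" by simp
  qed
  ultimately show False using primitive by (simp add: primitive_character_def)
qed

lemma twisted_sum_eq: "twisted_sum n = cnj (chi n) * gauss_sum q chi"
  using twisted_sum_coprime[of n] twisted_sum_not_coprime[of n] chi_nonzero_iff[of n]
  by (cases "coprime n (int q)") auto

lemma chi_0: "chi 0 = 0"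
  using chi_nonzero_iff[of 0] q_ge_2 by auto

text \<open>Frequency 0 of the twisted sum, where \<open>chi 0 = 0\<close>.\<close>

lemma sum_chi_eq_0: "(\<Sum>k\<in>{0..<int q}. chi k) = 0"
  using twisted_sum_eq[of 0] by (simp add: twisted_sum_def unit_root_def chi_0)

text \<open>Expand \<open>cnj \<tau>\<close>, absorb \<open>cnj (chi k) * \<tau>\<close> into a
  twisted sum, and exchange the sums; orthogonality leaves only \<open>l = 1\<close>.\<close>

lemma norm_gauss_sum: "norm (gauss_sum q chi) = sqrt (real q)"
proof -
  define \<tau> where "\<tau> = gauss_sum q chi"
  have cnj_root: "cnj (unit_root q k) = unit_root q (- k)" for k
    by (simp add: unit_root_def cis_cnj)
  have "cnj \<tau> * \<tau> = (\<Sum>k\<in>{0..<int q}. unit_root q (- k) * twisted_sum k)"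
    unfolding \<tau>_def twisted_sum_eq
    by (subst gauss_sum_eq)
       (simp add: twisted_sum_def cnj_root sum_distrib_left mult_ac)
  also have "\<dots> = (\<Sum>k\<in>{0..<int q}. \<Sum>l\<in>{0..<int q}. chi l * unit_root q (k * (l - 1)))"
    by (simp add: twisted_sum_def sum_distrib_left right_diff_distrib mult_ac
             flip: unit_root_add)
  also have "\<dots> = (\<Sum>l\<in>{0..<int q}. chi l * (\<Sum>k\<in>{0..<int q}. unit_root q (k * (l - 1))))"
    by (subst sum.swap) (simp add: sum_distrib_left)
  also have "\<dots> = (\<Sum>l\<in>{0..<int q}. if l = 1 then of_nat q else 0)"
  proof (rule sum.cong[OF refl])
    fix l assume l: "l \<in> {0..<int q}"
    have "int q dvd l - 1 \<longleftrightarrow> l = 1"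
    proof
      assume "int q dvd l - 1"
      then have "\<bar>l - 1\<bar> < int q \<Longrightarrow> l - 1 = 0"
        using dvd_imp_le_int[of "l - 1" "int q"] by force
      then show "l = 1" using l q_ge_2 by auto
    qed simp
    then show "chi l * (\<Sum>k\<in>{0..<int q}. unit_root q (k * (l - 1))) = (if l = 1 then of_nat q else 0)"
      by (simp add: sum_unit_root[OF q_pos] chi_1)
  qed
  also have "\<dots> = of_nat q" using q_ge_2 by simp
  finally have "of_real ((norm \<tau>)\<^sup>2) = (of_real (real q) :: complex)"
    unfolding complex_norm_square by (simp add: mult.commute)
  then have "(norm \<tau>)\<^sup>2 = real q" by (simp only: of_real_eq_iff)
  then show ?thesis unfolding \<tau>_def by (metis norm_ge_zero real_sqrt_unique)
qed

text \<open>Writing the sine through exponentials gives twisted sums at frequencies \<open>n\<close>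
  and \<open>- n\<close>. The two differ by the sign \<open>chi (- 1)\<close>, which decides between
  cosine and sine in \<open>parity_kernel\<close>.\<close>

lemma sum_chi_sin:
  "(\<Sum>k\<in>{0..<int q}. chi k * of_real (sin (2 * pi * real n * (\<alpha> - real_of_int k / real q))))
   = cnj (chi (int n)) * gauss_sum q chi * parity_kernel chi (2 * pi * real n * \<alpha>) / \<i>"
proof -
  define z where "z = cis (2 * pi * real n * \<alpha>)"
  have sin_eq: "of_real (sin (2 * pi * real n * (\<alpha> - real_of_int k / real q)))
     = (z * unit_root q (- int n * k) - cnj z * unit_root q (int n * k)) / (2 * \<i>)" for k
  proof -
    have "of_real (sin x) = (cis x - cis (- x)) / (2 * \<i>)" for x
      by (simp add: complex_eq_iff)
    moreover have "2 * pi * real n * (\<alpha> - real_of_int k / real q)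
       = 2 * pi * real n * \<alpha> + 2 * pi * real_of_int (- int n * k) / real q"
      by (simp add: right_diff_distrib)
    moreover have "- (2 * pi * real n * \<alpha> + 2 * pi * real_of_int (- int n * k) / real q)
       = - (2 * pi * real n * \<alpha>) + 2 * pi * real_of_int (int n * k) / real q"
      by simp
    ultimately show ?thesis
      by (simp only: unit_root_def z_def cis_cnj cis_mult)
  qed
  have "(\<Sum>k\<in>{0..<int q}. chi k * of_real (sin (2 * pi * real n * (\<alpha> - real_of_int k / real q))))
     = (z * twisted_sum (- int n) - cnj z * twisted_sum (int n)) / (2 * \<i>)"
    unfolding sin_eq twisted_sum_def sum_distrib_left
    by (simp only: sum_subtractf[symmetric] sum_divide_distrib) (simp add: algebra_simps)
  also have "\<dots> = cnj (chi (int n)) * gauss_sum q chi * ((chi (- 1) * z - cnj z) / (2 * \<i>))"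
    using chi_minus_1 by (auto simp: twisted_sum_eq chi_minus[of "int n"] algebra_simps)
  also have "(chi (- 1) * z - cnj z) / (2 * \<i>) = parity_kernel chi (2 * pi * real n * \<alpha>) / \<i>"
    using chi_minus_1 by (auto simp: parity_kernel_def z_def complex_eq_iff)
  finally show ?thesis by simp
qed

end

section \<open>Replacing the smooth weight by a sharp cutoff\<close>

text \<open>Split the series at the cutoff. The head has fewer than \<open>B\<close> terms, each
  changed by at most \<open>pi / B\<close>; the tail is at most 1. The total \<open>pi + 1\<close>
  is below 5.\<close>

lemma smoothing_error:
  fixes c :: "nat \<Rightarrow> complex" and B :: real
  assumes c: "\<And>n. norm (c n) \<le> 1" and B: "B \<ge> 1"
    and S: "(\<lambda>n. c (Suc n) / of_nat (Suc n)
              * of_real (B * sin (2 * pi * real (Suc n) / B) / (2 * pi * real (Suc n)))) sums S"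
  shows "norm (S - (\<Sum>n | 1 \<le> n \<and> real n < B. c n / of_nat n)) \<le> 5"
proof -
  define w where "w x = B * sin (2 * pi * x / B) / (2 * pi * x)" for x
  define g where "g n = c (Suc n) / of_nat (Suc n) * of_real (w (real (Suc n)))" for n
  \<comment> \<open>The largest integer strictly below \<open>B\<close>, matching the strict cutoff;
    it is 0 when \<open>B = 1\<close>.\<close>
  define N where "N = nat \<lceil>B\<rceil> - 1"
  have N: "real N < B" "B \<le> real N + 1"
  proof -
    have "\<lceil>B\<rceil> \<ge> 1" using B by linarith
    then have "int N = \<lceil>B\<rceil> - 1" unfolding N_def by arith
    then show "real N < B" "B \<le> real N + 1" by linarith+
  qed
  have "{n. 1 \<le> n \<and> real n < B} = Suc ` {..<N}"
  proof (intro equalityI subsetI)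
    fix n assume n: "n \<in> {n. 1 \<le> n \<and> real n < B}"
    then have "real n < real (N + 1)" using N(2) by simp
    then have "n - 1 < N" "n = Suc (n - 1)" using n by (auto simp del: of_nat_add)
    then show "n \<in> Suc ` {..<N}" by blast
  next
    fix n assume "n \<in> Suc ` {..<N}"
    then have "1 \<le> n" "n \<le> N" by auto
    then show "n \<in> {n. 1 \<le> n \<and> real n < B}" using N(1) by auto
  qed
  then have main: "(\<Sum>n | 1 \<le> n \<and> real n < B. c n / of_nat n) = (\<Sum>n<N. c (Suc n) / of_nat (Suc n))"
    by (simp add: sum.reindex del: of_nat_Suc)
  have "norm ((\<Sum>n<N. g n) - (\<Sum>n<N. c (Suc n) / of_nat (Suc n))) \<le> real N * (pi / B)"
  proof -
    have "norm (g n - c (Suc n) / of_nat (Suc n)) \<le> pi / B" for n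
    proof -
      define y where "y = 2 * pi * real (Suc n) / B"
      have y: "y > 0" using B by (simp add: y_def)
      \<comment> \<open>A quadratic bound suffices: dividing by \<open>y\<close> and by the index
        leaves \<open>pi / B\<close>, independent of \<open>n\<close>.\<close>
      have "\<bar>sin y - y\<bar> \<le> y\<^sup>2 / 2"
        using Maclaurin_sin_bound[of y 2] by (simp add: eval_nat_numeral sin_coeff_def)
      moreover have "w (real (Suc n)) - 1 = (sin y - y) / y"
        using B by (simp add: w_def y_def field_simps del: of_nat_Suc)
      ultimately have "\<bar>w (real (Suc n)) - 1\<bar> \<le> y\<^sup>2 / 2 / y"
        using y divide_right_mono[of "\<bar>sin y - y\<bar>" "y\<^sup>2 / 2" y]
        by (simp only: abs_divide abs_of_pos)
      then have w1: "\<bar>w (real (Suc n)) - 1\<bar> \<le> y / 2"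
        using y by (simp only: power2_eq_square) simp
      have "g n - c (Suc n) / of_nat (Suc n)
          = c (Suc n) * of_real ((w (real (Suc n)) - 1) / real (Suc n))"
        by (simp add: g_def diff_divide_distrib right_diff_distrib)
      then have "norm (g n - c (Suc n) / of_nat (Suc n))
          = norm (c (Suc n)) * (\<bar>w (real (Suc n)) - 1\<bar> / real (Suc n))"
        by (simp only: norm_mult norm_of_real abs_divide abs_of_nat)
      also have "\<dots> \<le> 1 * ((y / 2) / real (Suc n))"
        by (intro mult_mono divide_right_mono w1 c) auto
      also have "\<dots> = pi / B" by (simp add: y_def)
      finally show ?thesis .
    qed
    then have "norm (\<Sum>n<N. g n - c (Suc n) / of_nat (Suc n)) \<le> (\<Sum>n<N. pi / B)"
      by (intro sum_norm_le)
    then show ?thesis by (simp add: sum_subtractf)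
  qed
  also have "\<dots> \<le> pi"
    using N B by (simp add: field_simps)
  finally have head: "norm ((\<Sum>n<N. g n) - (\<Sum>n<N. c (Suc n) / of_nat (Suc n))) \<le> pi" .
  \<comment> \<open>A telescoping majorant for the tail: with \<open>x = n + N + 1\<close>, the term
    \<open>1 / x^2\<close> is at most
    \<open>1 / (x^2 - 1/4) = 1 / (x - 1/2) - 1 / (x + 1/2)\<close>.\<close>
  define h where "h n = 1 / (real n + real N + 1 / 2)" for n
  have h_lim: "h \<longlonglongrightarrow> 0"
  proof -
    have "filterlim (\<lambda>n. real N + 1 / 2 + real n) at_top sequentially"
      by (intro filterlim_tendsto_add_at_top[OF tendsto_const] filterlim_real_sequentially)
    then have "((\<lambda>n. 1 / (real N + 1 / 2 + real n)) \<longlongrightarrow> 0) sequentially"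
      by (intro tendsto_divide_0[OF tendsto_const] filterlim_at_top_imp_at_infinity)
    then show ?thesis by (simp add: h_def[abs_def] add_ac)
  qed
  have g_le: "norm (g (n + N)) \<le> B / (2 * pi) * (h n - h (Suc n))" for n
  proof -
    define x where "x = real (Suc (n + N))"
    have x: "x \<ge> 1" by (simp add: x_def)
    have "g (n + N) = c (Suc (n + N)) * of_real (w x / x)"
      by (simp add: g_def x_def mult.commute)
    then have "norm (g (n + N)) = norm (c (Suc (n + N))) * (\<bar>B * sin (2 * pi * x / B)\<bar> / (2 * pi * x) / x)"
      using x by (simp add: w_def norm_mult norm_divide abs_mult)
    also have "\<dots> \<le> 1 * (B / (2 * pi * x) / x)"
      using x B by (intro mult_mono divide_right_mono c) (auto simp: abs_mult mult_left_le)
    also have "\<dots> = B / (2 * pi) * (1 / x\<^sup>2)"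
      by (simp add: power2_eq_square)
    also have "\<dots> \<le> B / (2 * pi) * (1 / (x\<^sup>2 - 1 / 4))"
    proof -
      have "x\<^sup>2 \<ge> 1" using one_le_power[OF x] .
      then show ?thesis using B by (intro mult_left_mono frac_le) auto
    qed
    also have "1 / (x\<^sup>2 - 1 / 4) = h n - h (Suc n)"
    proof -
      have "h n - h (Suc n) = 1 / (x - 1 / 2) - 1 / (x + 1 / 2)"
        by (simp add: h_def x_def add_ac)
      also have "\<dots> = 1 / ((x - 1 / 2) * (x + 1 / 2))"
        using x by (subst diff_frac_eq) auto
      also have "(x - 1 / 2) * (x + 1 / 2) = x\<^sup>2 - 1 / 4"
        by (simp add: algebra_simps power2_eq_square)
      finally show ?thesis by simp
    qed
    finally show ?thesis .
  qed
  have "g sums S" using S by (simp only: g_def[abs_def] w_def)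
  from norm_sums_le[OF sums_split_initial_segment[OF this, of N]
         sums_mult[OF telescope_sums'[OF h_lim], of "B / (2 * pi)"] g_le]
  have "norm (S - (\<Sum>n<N. g n)) \<le> B / (2 * pi) * h 0" by simp
  \<comment> \<open>Here \<open>h 0 = 1 / (N + 1/2)\<close>, and
    \<open>B \<le> N + 1 \<le> 2 * N + 1\<close>, also when \<open>N = 0\<close>.\<close>
  also have "\<dots> \<le> B / (2 * pi) * (2 / B)"
    using N B by (intro mult_left_mono) (auto simp: h_def field_simps)
  also have "\<dots> \<le> 1"
    using B pi_ge_two by (simp add: field_simps)
  finally have "norm (S - (\<Sum>n<N. g n)) \<le> 1" .
  with head have "norm ((S - (\<Sum>n<N. g n))
      + ((\<Sum>n<N. g n) - (\<Sum>n<N. c (Suc n) / of_nat (Suc n)))) \<le> 1 + pi"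
    by (intro norm_triangle_le) linarith
  also have "\<dots> \<le> 5" using pi_less_4 by simp
  finally show ?thesis unfolding main by simp
qed

section \<open>The averaged character sum\<close>

context primitive_char
begin

text \<open>As functions of the integer part \<open>m\<close> of \<open>x\<close>, both sides vanish
  at 0 and grow by \<open>chi m\<close> from \<open>m - 1\<close> to \<open>m\<close>. Induction in
  both directions covers negative \<open>x\<close>, in agreement with the oriented sum.\<close>

lemma char_sum_eq_floor:
  "char_sum chi x = (\<Sum>k\<in>{0..<int q}. chi k * of_int ((\<lfloor>x\<rfloor> - k) div int q))"
proof -
  define T where "T m = (\<Sum>n\<in>{1..m}. chi n) - (\<Sum>n\<in>{m<..0}. chi n)" for m
  define R where "R m = (\<Sum>k\<in>{0..<int q}. chi k * of_int ((m - k) div int q))" for m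
  have T_step: "T m = T (m - 1) + chi m" for m
  proof (cases "m \<ge> 1")
    case True
    then have "{1..m} = insert m {1..m - 1}" "{m<..0} = {}" "{m - 1<..0} = {}" by auto
    then show ?thesis by (simp add: T_def)
  next
    case False
    then have "{m - 1<..0} = insert m {m<..0}" "{1..m} = {}" "{1..m - 1} = {}" by auto
    then show ?thesis by (simp add: T_def)
  qed
  have R_step: "R m = R (m - 1) + chi m" for m
  proof -
    \<comment> \<open>Only the residue class containing \<open>m\<close> gains an element in the
      step from \<open>m - 1\<close> to \<open>m\<close>.\<close>
    have div_step: "(m - k) div int q - (m - 1 - k) div int q = (if k = m mod int q then 1 else 0)"
      if "k \<in> {0..<int q}" for k
    proof -
      define u where "u = m div int q"
      define v where "v = m mod int q"
      have m: "m = int q * u + v" and v: "0 \<le> v" "v < int q"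
        using q_pos by (simp_all add: u_def v_def)
      have div_eq: "(int q * u + z) div int q = u + (if z < 0 then - 1 else 0)"
        if "- int q \<le> z" "z < int q" for z
      proof (cases "z < 0")
        case True
        have "int q * u + z = int q * (u - 1) + (z + int q)" by (simp add: algebra_simps)
        moreover have "(z + int q) div int q = 0" using True that by (intro div_pos_pos_trivial) auto
        moreover have "(int q * (u - 1) + (z + int q)) div int q = u - 1 + (z + int q) div int q"
          using q_pos by (intro div_mult_self4) simp
        ultimately show ?thesis using True by (simp only:) simp
      next
        case False
        then have "z div int q = 0" using that by (intro div_pos_pos_trivial) auto
        with False q_pos show ?thesis by simp
      qed
      have "(m - k) div int q = u + (if v - k < 0 then - 1 else 0)"
        using div_eq[of "v - k"] v that by (simp add: m algebra_simps)
      moreover have "(m - 1 - k) div int q = u + (if v - 1 - k < 0 then - 1 else 0)"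
        using div_eq[of "v - 1 - k"] v that by (simp add: m algebra_simps)
      ultimately show ?thesis unfolding v_def[symmetric] by auto
    qed
    have "R m - R (m - 1)
        = (\<Sum>k\<in>{0..<int q}. chi k * of_int ((m - k) div int q - (m - 1 - k) div int q))"
      by (simp add: R_def sum_subtractf right_diff_distrib)
    also have "\<dots> = (\<Sum>k\<in>{0..<int q}. if k = m mod int q then chi k else 0)"
      by (rule sum.cong) (auto simp: div_step)
    also have "\<dots> = chi (m mod int q)" using q_pos by simp
    also have "\<dots> = chi m" by (rule chi_cong) simp
    finally show ?thesis by (simp add: algebra_simps)
  qed
  \<comment> \<open>The quotient is \<open>- 1\<close> for \<open>0 < k < q\<close> but 0 for
    \<open>k = 0\<close>; the exception is absorbed by \<open>chi 0 = 0\<close>.\<close>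
  have "R 0 = (\<Sum>k\<in>{0..<int q}. - chi k)"
    unfolding R_def
  proof (rule sum.cong[OF refl])
    fix k assume k: "k \<in> {0..<int q}"
    show "chi k * of_int ((0 - k) div int q) = - chi k"
    proof (cases "k = 0")
      case False
      then have "(- k) div int q = - 1" using k by (simp add: zdiv_zminus1_eq_if)
      then show ?thesis by simp
    qed (simp add: chi_0)
  qed
  then have R0: "R 0 = 0" by (simp add: sum_negf sum_chi_eq_0)
  have "T m = R m" for m
  proof (induction m rule: int_induct[where k = 0])
    case base
    show ?case by (simp add: R0 T_def)
  next
    case (step1 i)
    then show ?case using T_step[of "i + 1"] R_step[of "i + 1"] by simp
  next
    case (step2 i)
    then show ?case using T_step[of i] R_step[of i] by simp
  qed
  moreover have "char_sum chi x = T \<lfloor>x\<rfloor>"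
  proof -
    have "{n. 1 \<le> n \<and> real_of_int n \<le> x} = {1..\<lfloor>x\<rfloor>}" "{n. x < real_of_int n \<and> n \<le> 0} = {\<lfloor>x\<rfloor><..0}"
      by (auto simp: le_floor_iff floor_less_iff)
    then show ?thesis by (simp add: char_sum_def T_def)
  qed
  ultimately show ?thesis by (simp add: R_def)
qed

lemma sum_chi_linear_eq_sawtooth:
  "(\<Sum>k\<in>{0..<int q}. chi k * of_real (real_of_int k / real q))
   = (\<Sum>k\<in>{0..<int q}. chi k * of_real (sawtooth (real_of_int k / real q)))"
proof -
  have "chi k * of_real (sawtooth (real_of_int k / real q))
      = chi k * of_real (real_of_int k / real q) - chi k / 2" if "k \<in> {0..<int q}" for k
  proof -
    have "frac (real_of_int k / real q) = real_of_int k / real q"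
      using that by (subst frac_eq) auto
    then show ?thesis by (simp add: sawtooth_def algebra_simps)
  qed
  then show ?thesis
    by (simp add: sum_subtractf sum_chi_eq_0 flip: sum_divide_distrib)
qed

text \<open>Replace \<open>k / q\<close> by its sawtooth, insert the Fourier series at these points,
  and sum over \<open>k\<close> first: \<open>sum_chi_sin\<close> at \<open>\<alpha> = 0\<close>
  produces the series for \<open>L_one\<close>. The point \<open>k = 0\<close>, where the Fourier
  series fails, has weight \<open>chi 0 = 0\<close>.\<close>

lemma main_term_eq:
  "main_term q chi = - (\<Sum>k\<in>{0..<int q}. chi k * of_real (real_of_int k / real q))"
proof -
  \<comment> \<open>The kernel at 0 is \<open>- 1\<close> for odd and 0 for even characters, that is
    \<open>- (1 - chi (- 1)) / 2\<close>.\<close>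
  define K where "K = gauss_sum q chi * parity_kernel chi 0 / \<i>"
  define A where "A = (\<Sum>k\<in>{0..<int q}. chi k * of_real (sawtooth (real_of_int k / real q)))"
  have "(\<lambda>n. chi k * of_real (sin (2 * pi * real (Suc n) * (0 - real_of_int k / real q)) / real (Suc n)))
          sums (chi k * of_real (pi * sawtooth (real_of_int k / real q)))" if k: "k \<in> {0..<int q}" for k
  proof (cases "k = 0")
    case False
    have "real_of_int k / real q \<notin> \<int>"
    proof
      assume "real_of_int k / real q \<in> \<int>"
      then obtain m :: int where "real_of_int k / real q = real_of_int m" by (elim Ints_cases)
      then have "real_of_int k = real_of_int (int q * m)" using q_pos by (simp add: field_simps)
      then have "k = int q * m" by (simp only: of_int_eq_iff)
      then have "int q dvd k" by simp
      with k False show False by (auto dest: zdvd_imp_le)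
    qed
    from sums_minus[OF sin_series_sums_sawtooth[OF this]]
    have "(\<lambda>n. sin (2 * pi * real (Suc n) * (0 - real_of_int k / real q)) / real (Suc n))
          sums (pi * sawtooth (real_of_int k / real q))"
      by (simp del: of_nat_Suc)
    then show ?thesis by (intro sums_mult sums_of_real)
  qed (simp add: chi_0)
  then have "(\<lambda>n. \<Sum>k\<in>{0..<int q}. chi k *
            of_real (sin (2 * pi * real (Suc n) * (0 - real_of_int k / real q)) / real (Suc n)))
          sums (\<Sum>k\<in>{0..<int q}. chi k * of_real (pi * sawtooth (real_of_int k / real q)))"
    by (rule sums_sum)
  also have "(\<Sum>k\<in>{0..<int q}. chi k * of_real (pi * sawtooth (real_of_int k / real q)))
      = of_real pi * A"
    by (simp add: A_def sum_distrib_left mult_ac)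
  finally
  have "(\<lambda>n. \<Sum>k\<in>{0..<int q}. chi k *
            of_real (sin (2 * pi * real (Suc n) * (0 - real_of_int k / real q)) / real (Suc n)))
          sums (of_real pi * A)" .
  also have "(\<lambda>n. \<Sum>k\<in>{0..<int q}. chi k *
            of_real (sin (2 * pi * real (Suc n) * (0 - real_of_int k / real q)) / real (Suc n)))
      = (\<lambda>n. K * (cnj (chi (int (Suc n))) / of_nat (Suc n)))"
  proof
    fix n
    have "(\<Sum>k\<in>{0..<int q}. chi k *
            of_real (sin (2 * pi * real (Suc n) * (0 - real_of_int k / real q)) / real (Suc n)))
       = (\<Sum>k\<in>{0..<int q}. chi k *
            of_real (sin (2 * pi * real (Suc n) * (0 - real_of_int k / real q)))) / of_nat (Suc n)"
      by (simp only: of_real_divide of_real_of_nat_eq times_divide_eq_right sum_divide_distrib)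
    then show "(\<Sum>k\<in>{0..<int q}. chi k *
            of_real (sin (2 * pi * real (Suc n) * (0 - real_of_int k / real q)) / real (Suc n)))
       = K * (cnj (chi (int (Suc n))) / of_nat (Suc n))"
      unfolding sum_chi_sin by (simp add: K_def mult_ac del: of_nat_Suc)
  qed
  finally have sums: "(\<lambda>n. K * (cnj (chi (int (Suc n))) / of_nat (Suc n))) sums (of_real pi * A)" .
  \<comment> \<open>If \<open>K \<noteq> 0\<close>, convergence of the series for \<open>L(1, cnj \<chi>)\<close> is read off from \<open>sums\<close>;
    if \<open>K = 0\<close>, it is not needed.\<close>
  have "K * L_one (\<lambda>n. cnj (chi n)) = of_real pi * A"
  proof (cases "K = 0")
    case True
    with sums have "(\<lambda>n. 0) sums (of_real pi * A)" by simp
    then have "of_real pi * A = 0" by (metis sums_unique2 sums_zero)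
    with True show ?thesis by simp
  next
    case False
    from sums_mult_D[OF sums False] show ?thesis
      using False unfolding L_one_def by (simp add: sums_iff)
  qed
  moreover have "main_term q chi = - (K * L_one (\<lambda>n. cnj (chi n))) / of_real pi"
    using chi_minus_1 by (auto simp: main_term_def K_def parity_kernel_def field_simps)
  ultimately have "main_term q chi = - A" by simp
  then show ?thesis unfolding A_def sum_chi_linear_eq_sawtooth .
qed

text \<open>Write the floor of \<open>y = t - k/q\<close> as \<open>y - 1/2 - sawtooth y\<close>.
  The part independent of \<open>k\<close> is killed by \<open>sum_chi_eq_0\<close>, and
  \<open>- k/q\<close> sums to the main term.\<close>

lemma char_sum_eq_sawtooth:
  "char_sum chi (t * real q)
   = main_term q chi - (\<Sum>k\<in>{0..<int q}. chi k * of_real (sawtooth (t - real_of_int k / real q)))"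
proof -
  have "chi k * of_int ((\<lfloor>t * real q\<rfloor> - k) div int q)
      = chi k * of_real (t - 1 / 2) - chi k * of_real (real_of_int k / real q)
        - chi k * of_real (sawtooth (t - real_of_int k / real q))" for k
  proof -
    \<comment> \<open>Nested floors collapse: the inner floor may be dropped before dividing by the
      integer \<open>q\<close>.\<close>
    have "(\<lfloor>t * real q\<rfloor> - k) div int q = \<lfloor>(t * real q - real_of_int k) / real_of_int (int q)\<rfloor>"
      by (subst floor_divide_real_eq_div) auto
    also have "(t * real q - real_of_int k) / real_of_int (int q) = t - real_of_int k / real q"
      using q_pos by (simp add: field_simps)
    finally have "real_of_int ((\<lfloor>t * real q\<rfloor> - k) div int q)
        = t - 1 / 2 - real_of_int k / real q - sawtooth (t - real_of_int k / real q)"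
      by (simp add: sawtooth_def frac_def)
    then have "(of_int ((\<lfloor>t * real q\<rfloor> - k) div int q) :: complex)
        = of_real (t - 1 / 2 - real_of_int k / real q - sawtooth (t - real_of_int k / real q))"
      by (metis of_real_of_int_eq)
    then show ?thesis by (simp add: right_diff_distrib)
  qed
  then show ?thesis
    by (simp only: char_sum_eq_floor main_term_eq sum_subtractf sum_distrib_right[symmetric]
          sum_chi_eq_0) simp
qed

text \<open>Integrating each sawtooth gives differences of \<open>cos_series\<close>; their series
  are summed over \<open>k\<close> by \<open>sum_chi_sin\<close>. The last factor is the weight
  \<open>sin y / y\<close> with \<open>y = 2 pi n / B\<close>.\<close>

lemma integral_char_sum_sums:
  assumes B: "B \<ge> 1"
  shows "(\<lambda>n. gauss_sum q chi / (\<i> * of_real pi)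
            * (cnj (chi (int (Suc n))) * parity_kernel chi (2 * pi * real (Suc n) * \<alpha>) / of_nat (Suc n)
               * of_real (B * sin (2 * pi * real (Suc n) / B) / (2 * pi * real (Suc n)))))
         sums (of_real (B / 2) * integral {\<alpha> - 1 / B..\<alpha> + 1 / B} (\<lambda>t. char_sum chi (t * real q))
               - main_term q chi)"
proof -
  define x where "x k = \<alpha> - real_of_int k / real q" for k
  define D where "D k = cos_series (x k + 1 / B) - cos_series (x k - 1 / B)" for k
  have le: "\<alpha> - 1 / B - c \<le> \<alpha> + 1 / B - c" for c using B by simp
  have "((\<lambda>t. sawtooth (t - real_of_int k / real q)) has_integral D k / (2 * pi\<^sup>2))
          {\<alpha> - 1 / B..\<alpha> + 1 / B}" for k
    using has_integral_affinity'[OF sawtooth_has_integral[OF le[of "real_of_int k / real q"],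
            folded cbox_interval], of 1 "- (real_of_int k / real q)"]
    by (simp add: D_def x_def algebra_simps)
  then have "((\<lambda>t. main_term q chi
        - (\<Sum>k\<in>{0..<int q}. chi k * of_real (sawtooth (t - real_of_int k / real q)))) has_integral
      (measure lborel {\<alpha> - 1 / B..\<alpha> + 1 / B} *\<^sub>R main_term q chi
        - (\<Sum>k\<in>{0..<int q}. chi k * of_real (D k / (2 * pi\<^sup>2))))) {\<alpha> - 1 / B..\<alpha> + 1 / B}"
    by (intro has_integral_diff has_integral_const_real has_integral_sum has_integral_mult_right
          has_integral_of_real) auto
  then have integral: "integral {\<alpha> - 1 / B..\<alpha> + 1 / B} (\<lambda>t. char_sum chi (t * real q))
      = of_real (2 / B) * main_term q chi - (\<Sum>k\<in>{0..<int q}. chi k * of_real (D k / (2 * pi\<^sup>2)))"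
    using B unfolding char_sum_eq_sawtooth by (simp add: integral_unique scaleR_conv_of_real)
  \<comment> \<open>The factor \<open>- B / (4 * pi\<^sup>2)\<close> combines the normalisation
    \<open>B / 2\<close>, the antiderivative's \<open>1 / (2 * pi\<^sup>2)\<close> and the minus
    sign before the sawtooth sum.\<close>
  have "(\<lambda>n. chi k * of_real (- B / (4 * pi\<^sup>2) * (- 2 * sin (2 * pi * real (Suc n) * x k)
            * sin (2 * pi * real (Suc n) * (1 / B)) / real (Suc n) ^ 2)))
          sums (chi k * of_real (- B / (4 * pi\<^sup>2) * D k))" for k
    unfolding D_def by (intro sums_mult sums_of_real cos_series_diff_sums)
  then have "(\<lambda>n. \<Sum>k\<in>{0..<int q}. chi k * of_real (- B / (4 * pi\<^sup>2) *
            (- 2 * sin (2 * pi * real (Suc n) * x k)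
            * sin (2 * pi * real (Suc n) * (1 / B)) / real (Suc n) ^ 2)))
          sums (\<Sum>k\<in>{0..<int q}. chi k * of_real (- B / (4 * pi\<^sup>2) * D k))"
    by (intro sums_sum)
  moreover have "(\<Sum>k\<in>{0..<int q}. chi k * of_real (- B / (4 * pi\<^sup>2) * D k))
      = of_real (B / 2) * integral {\<alpha> - 1 / B..\<alpha> + 1 / B} (\<lambda>t. char_sum chi (t * real q))
        - main_term q chi"
    using B by (simp add: integral right_diff_distrib sum_distrib_left sum_negf mult_ac)
  moreover have "(\<Sum>k\<in>{0..<int q}. chi k * of_real (- B / (4 * pi\<^sup>2) *
            (- 2 * sin (2 * pi * N * x k) * sin (2 * pi * N * (1 / B)) / N ^ 2)))
      = gauss_sum q chi / (\<i> * of_real pi)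
            * (cnj (chi (int n)) * parity_kernel chi (2 * pi * N * \<alpha>) / of_nat n
               * of_real (B * sin (2 * pi * N / B) / (2 * pi * N)))" if N: "N = real n" for n N
  proof -
    have "(\<Sum>k\<in>{0..<int q}. chi k * of_real (- B / (4 * pi\<^sup>2) *
            (- 2 * sin (2 * pi * N * x k) * sin (2 * pi * N * (1 / B)) / N ^ 2)))
      = (\<Sum>k\<in>{0..<int q}. chi k * of_real (sin (2 * pi * N * x k)))
          * of_real (B * sin (2 * pi * N / B) / (2 * pi\<^sup>2 * N\<^sup>2))"
      unfolding sum_distrib_right by (rule sum.cong) (simp_all add: mult_ac)
    also have "\<dots> = cnj (chi (int n)) * gauss_sum q chi * parity_kernel chi (2 * pi * N * \<alpha>) / \<i>
          * of_real (B * sin (2 * pi * N / B) / (2 * pi\<^sup>2 * N\<^sup>2))"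
      unfolding x_def N sum_chi_sin ..
    also have "a * t * p / z * of_real (b / (2 * pi\<^sup>2 * N\<^sup>2))
        = t / (z * of_real pi) * (a * p / of_real N * of_real (b / (2 * pi * N)))"
      for a t p z :: complex and b by (simp add: power2_eq_square mult_ac)
    finally show ?thesis unfolding N of_real_of_nat_eq .
  qed
  ultimately show ?thesis by (simp only:)
qed

lemma norm_parity_kernel_le: "norm (parity_kernel chi x) \<le> 1"
  by (simp add: parity_kernel_def norm_mult)

lemma smoothed_char_sum_bound:
  assumes B: "B \<ge> 1"
  shows "cmod (of_real (B / 2) * integral {\<alpha> - 1 / B..\<alpha> + 1 / B} (\<lambda>t. char_sum chi (t * real q))
             - (main_term q chi
                + gauss_sum q chi / (\<i> * of_real pi)
                  * (\<Sum>n::nat | 1 \<le> n \<and> real n < B.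
                       cnj (chi (int n)) / of_nat n * parity_kernel chi (2 * pi * real n * \<alpha>))))
       \<le> 2 * sqrt (real q)"
proof -
  define K where "K = gauss_sum q chi / (\<i> * of_real pi)"
  define c where "c n = cnj (chi (int n)) * parity_kernel chi (2 * pi * real n * \<alpha>)" for n
  define J where "J = of_real (B / 2)
      * integral {\<alpha> - 1 / B..\<alpha> + 1 / B} (\<lambda>t. char_sum chi (t * real q)) - main_term q chi"
  have norm_K: "norm K = sqrt (real q) / pi"
    by (simp add: K_def norm_divide norm_mult norm_gauss_sum)
  \<comment> \<open>Dividing by \<open>K\<close> leaves a series with coefficients bounded by 1, as
    \<open>smoothing_error\<close> requires.\<close>
  then have "K \<noteq> 0" using q_pos by auto
  have c: "norm (c n) \<le> 1" for n
    unfolding c_def norm_mult complex_mod_cnj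
    by (intro mult_le_one norm_chi_le norm_parity_kernel_le) auto
  have "(\<lambda>n. c (Suc n) / of_nat (Suc n)
          * of_real (B * sin (2 * pi * real (Suc n) / B) / (2 * pi * real (Suc n)))) sums (J / K)"
    using sums_mult_D[OF integral_char_sum_sums[OF B, of \<alpha>, folded K_def J_def] \<open>K \<noteq> 0\<close>]
    by (simp only: c_def)
  from smoothing_error[OF c B this]
  have "norm K * norm (J / K - (\<Sum>n | 1 \<le> n \<and> real n < B. c n / of_nat n)) \<le> norm K * 5"
    by (intro mult_left_mono) auto
  also have "norm K * norm (J / K - (\<Sum>n | 1 \<le> n \<and> real n < B. c n / of_nat n))
      = norm (J - K * (\<Sum>n | 1 \<le> n \<and> real n < B. c n / of_nat n))"
    unfolding norm_mult[symmetric] using \<open>K \<noteq> 0\<close> by (simp add: right_diff_distrib)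
  also have "norm K * 5 \<le> 2 * sqrt (real q)"
  proof -
    \<comment> \<open>The smoothing error 5 times \<open>norm K\<close> is \<open>5 / pi\<close>
      times the root of \<open>q\<close>, and \<open>5 < 2 * pi\<close>; hence the absolute constant
      2.\<close>
    have "sqrt (real q) * 5 \<le> sqrt (real q) * (2 * pi)"
      using pi_gt3 by (intro mult_left_mono) auto
    then show ?thesis by (simp add: norm_K field_simps)
  qed
  finally show ?thesis by (simp add: J_def K_def c_def algebra_simps)
qed

end

theorem theorem1:
  "\<exists>C::real. \<forall>(q::nat) (chi::int \<Rightarrow> complex) (B::real) (\<alpha>::real).
     q \<ge> 2 \<longrightarrow> primitive_character q chi \<longrightarrow> B \<ge> 1 \<longrightarrow>
       cmod (of_real (B / 2) * integral {\<alpha> - 1 / B..\<alpha> + 1 / B} (\<lambda>t. char_sum chi (t * real q))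
             - (main_term q chi
                + gauss_sum q chi / (\<i> * of_real pi)
                  * (\<Sum>n::nat | 1 \<le> n \<and> real n < B.
                       cnj (chi (int n)) / of_nat n * parity_kernel chi (2 * pi * real n * \<alpha>))))
       \<le> C * sqrt (real q)"
  by (intro exI[of _ 2] allI impI primitive_char.smoothed_char_sum_bound)
     (auto intro: primitive_char.intro)

end
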